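(* Let $T$ be a truss and let $I$ be the truss on a singleton set $\{1\}$. Then the multiplication $\cdot$ on $T\boxplus I$ given on the generating elements $T\sqcup\{1\}$ by $$1\cdot t=t\cdot 1=t,\qquad t\cdot t'=tt',\qquad 1\cdot 1=1\qquad (t,t'\in T),$$ where $tt'$ is the product in $T$, and extended to all of $T\boxplus I$ by distributivity over the heap operation, is well defined and makes $T\boxplus I$ into a unital truss (with identity $1$).
   Context: A heap is a set $H$ (possibly empty) with a ternary operation $[-,-,-]$ such that $[[a,b,c],d,e]=[a,b,[c,d,e]]$ and $[a,b,b]=a=[b,b,a]$ for all $a,b,c,d,e\in H$. It is Abelian if $[a,b,c]=[c,b,a]$. A truss is an Abelian heap $T$ with an associative binary multiplication satisfying $s[t,t',t'']=[st,st',st'']$ and $[t,t',t'']s=[ts,t's,t''s]$ for all $s,t,t',t''\in T$; it is unital if the multiplication has an identity. $T\boxplus I$ denotes the direct sum (coproduct in the category of Abelian heaps) of the underlying Abelian heaps of $T$ and $I$; $T$ and $\{1\}$ are identified with their images in $T\boxplus I$, and the heap $T\boxplus I$ is generated by $T\sqcup\{1\}$. *)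

theory Defs
  imports "HOL-Algebra.Congruence"
begin

section \<open>Abelian heaps\<close>

record 'a heap = "'a partial_object" +
  hop :: "'a \<Rightarrow> 'a \<Rightarrow> 'a \<Rightarrow> 'a"

text \<open>The carrier may be empty.\<close>

locale heap =
  fixes H :: "('a, 'm) heap_scheme"
  assumes hop_closed:
      "\<lbrakk>a \<in> carrier H; b \<in> carrier H; c \<in> carrier H\<rbrakk> \<Longrightarrow> hop H a b c \<in> carrier H"
    and hop_assoc:
      "\<lbrakk>a \<in> carrier H; b \<in> carrier H; c \<in> carrier H; d \<in> carrier H; e \<in> carrier H\<rbrakk>
        \<Longrightarrow> hop H (hop H a b c) d e = hop H a b (hop H c d e)"
    and hop_cancel_right: "\<lbrakk>a \<in> carrier H; b \<in> carrier H\<rbrakk> \<Longrightarrow> hop H a b b = a"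
    and hop_cancel_left: "\<lbrakk>a \<in> carrier H; b \<in> carrier H\<rbrakk> \<Longrightarrow> hop H b b a = a"

locale abelian_heap = heap +
  assumes hop_comm:
    "\<lbrakk>a \<in> carrier H; b \<in> carrier H; c \<in> carrier H\<rbrakk> \<Longrightarrow> hop H a b c = hop H c b a"

definition heap_hom :: "('a, 'm) heap_scheme \<Rightarrow> ('b, 'n) heap_scheme \<Rightarrow> ('a \<Rightarrow> 'b) set" where
  "heap_hom A B = {f \<in> carrier A \<rightarrow> carrier B.
     \<forall>a \<in> carrier A. \<forall>b \<in> carrier A. \<forall>c \<in> carrier A.
       f (hop A a b c) = hop B (f a) (f b) (f c)}"


section \<open>Trusses\<close>

record 'a truss = "'a heap" +
  tmult :: "'a \<Rightarrow> 'a \<Rightarrow> 'a"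

locale truss = abelian_heap T for T :: "('a, 'm) truss_scheme" +
  assumes tmult_closed:
      "\<lbrakk>s \<in> carrier T; t \<in> carrier T\<rbrakk> \<Longrightarrow> tmult T s t \<in> carrier T"
    and tmult_assoc:
      "\<lbrakk>r \<in> carrier T; s \<in> carrier T; t \<in> carrier T\<rbrakk>
        \<Longrightarrow> tmult T (tmult T r s) t = tmult T r (tmult T s t)"
    and tmult_hop_left:
      "\<lbrakk>s \<in> carrier T; t \<in> carrier T; t' \<in> carrier T; t'' \<in> carrier T\<rbrakk>
        \<Longrightarrow> tmult T s (hop T t t' t'') = hop T (tmult T s t) (tmult T s t') (tmult T s t'')"
    and tmult_hop_right:
      "\<lbrakk>s \<in> carrier T; t \<in> carrier T; t' \<in> carrier T; t'' \<in> carrier T\<rbrakk>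
        \<Longrightarrow> tmult T (hop T t t' t'') s = hop T (tmult T t s) (tmult T t' s) (tmult T t'' s)"

definition is_identity :: "('a, 'm) truss_scheme \<Rightarrow> 'a \<Rightarrow> bool" where
  "is_identity T e \<longleftrightarrow>
     e \<in> carrier T \<and> (\<forall>t \<in> carrier T. tmult T e t = t \<and> tmult T t e = t)"

locale unital_truss = truss +
  assumes ex_identity: "\<exists>e. is_identity T e"


section \<open>Direct sums (coproducts) of Abelian heaps\<close>

text \<open>
  The direct sum of \<open>A\<close> and \<open>B\<close> is the Abelian heap generated by the disjoint union of the
  two carriers, subject to the values of the heap operations of \<open>A\<close> and \<open>B\<close>: formal terms
  in the generators modulo the least congruence that contains the axioms of Abelian heaps and
  these relations. That it is the coproduct in the category of Abelian heaps is
  \<open>direct_sum_universal\<close> below.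
\<close>

datatype 'x hterm = Gen 'x | Op "'x hterm" "'x hterm" "'x hterm"

inductive_set dsum_terms ::
    "('a, 'm) heap_scheme \<Rightarrow> ('b, 'n) heap_scheme \<Rightarrow> ('a + 'b) hterm set"
  for A :: "('a, 'm) heap_scheme" and B :: "('b, 'n) heap_scheme"
where
  Inl: "a \<in> carrier A \<Longrightarrow> Gen (Inl a) \<in> dsum_terms A B"
| Inr: "b \<in> carrier B \<Longrightarrow> Gen (Inr b) \<in> dsum_terms A B"
| Op: "\<lbrakk>x \<in> dsum_terms A B; y \<in> dsum_terms A B; z \<in> dsum_terms A B\<rbrakk>
    \<Longrightarrow> Op x y z \<in> dsum_terms A B"

inductive_set dsum_rel ::
    "('a, 'm) heap_scheme \<Rightarrow> ('b, 'n) heap_scheme \<Rightarrow> ('a + 'b) hterm rel"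
  for A :: "('a, 'm) heap_scheme" and B :: "('b, 'n) heap_scheme"
where
  refl: "x \<in> dsum_terms A B \<Longrightarrow> (x, x) \<in> dsum_rel A B"
| sym: "(x, y) \<in> dsum_rel A B \<Longrightarrow> (y, x) \<in> dsum_rel A B"
| trans: "\<lbrakk>(x, y) \<in> dsum_rel A B; (y, z) \<in> dsum_rel A B\<rbrakk> \<Longrightarrow> (x, z) \<in> dsum_rel A B"
| cong: "\<lbrakk>(x, x') \<in> dsum_rel A B; (y, y') \<in> dsum_rel A B; (z, z') \<in> dsum_rel A B\<rbrakk>
    \<Longrightarrow> (Op x y z, Op x' y' z') \<in> dsum_rel A B"
| assoc: "\<lbrakk>v \<in> dsum_terms A B; w \<in> dsum_terms A B; x \<in> dsum_terms A B;
      y \<in> dsum_terms A B; z \<in> dsum_terms A B\<rbrakk>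
    \<Longrightarrow> (Op (Op v w x) y z, Op v w (Op x y z)) \<in> dsum_rel A B"
| cancel_right: "\<lbrakk>x \<in> dsum_terms A B; y \<in> dsum_terms A B\<rbrakk> \<Longrightarrow> (Op x y y, x) \<in> dsum_rel A B"
| cancel_left: "\<lbrakk>x \<in> dsum_terms A B; y \<in> dsum_terms A B\<rbrakk> \<Longrightarrow> (Op y y x, x) \<in> dsum_rel A B"
| comm: "\<lbrakk>x \<in> dsum_terms A B; y \<in> dsum_terms A B; z \<in> dsum_terms A B\<rbrakk>
    \<Longrightarrow> (Op x y z, Op z y x) \<in> dsum_rel A B"
| Inl: "\<lbrakk>a \<in> carrier A; a' \<in> carrier A; a'' \<in> carrier A\<rbrakk>
    \<Longrightarrow> (Gen (Inl (hop A a a' a'')), Op (Gen (Inl a)) (Gen (Inl a')) (Gen (Inl a'')))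
          \<in> dsum_rel A B"
| Inr: "\<lbrakk>b \<in> carrier B; b' \<in> carrier B; b'' \<in> carrier B\<rbrakk>
    \<Longrightarrow> (Gen (Inr (hop B b b' b'')), Op (Gen (Inr b)) (Gen (Inr b')) (Gen (Inr b'')))
          \<in> dsum_rel A B"

definition direct_sum ::
    "('a, 'm) heap_scheme \<Rightarrow> ('b, 'n) heap_scheme \<Rightarrow> ('a + 'b) hterm set heap"
    (infixl "\<boxplus>" 65) where
  "A \<boxplus> B = \<lparr>carrier = dsum_terms A B // dsum_rel A B,
     hop = (\<lambda>X Y Z. dsum_rel A B `` {Op x y z | x y z. x \<in> X \<and> y \<in> Y \<and> z \<in> Z})\<rparr>"

definition dsum_inl ::
    "('a, 'm) heap_scheme \<Rightarrow> ('b, 'n) heap_scheme \<Rightarrow> 'a \<Rightarrow> ('a + 'b) hterm set" where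
  "dsum_inl A B a = dsum_rel A B `` {Gen (Inl a)}"

definition dsum_inr ::
    "('a, 'm) heap_scheme \<Rightarrow> ('b, 'n) heap_scheme \<Rightarrow> 'b \<Rightarrow> ('a + 'b) hterm set" where
  "dsum_inr A B b = dsum_rel A B `` {Gen (Inr b)}"

lemma dsum_rel_terms:
  assumes "heap A" "heap B" "(x, y) \<in> dsum_rel A B"
  shows "x \<in> dsum_terms A B \<and> y \<in> dsum_terms A B"
  using assms(3)
  by induction (auto intro: dsum_terms.intros heap.hop_closed[OF assms(1)] heap.hop_closed[OF assms(2)])

lemma equiv_dsum_rel:
  assumes "heap A" "heap B"
  shows "equiv (dsum_terms A B) (dsum_rel A B)"
proof (rule equivI)
  show "dsum_rel A B \<subseteq> dsum_terms A B \<times> dsum_terms A B"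
    using dsum_rel_terms[OF assms] by auto
  show "refl_on (dsum_terms A B) (dsum_rel A B)"
    by (auto simp: refl_on_def intro: dsum_rel.refl)
  show "sym (dsum_rel A B)" by (auto intro: symI dsum_rel.sym)
  show "trans (dsum_rel A B)" by (blast intro: transI dsum_rel.trans)
qed

lemma carrier_direct_sumE:
  assumes "X \<in> carrier (A \<boxplus> B)"
  obtains x where "x \<in> dsum_terms A B" "X = dsum_rel A B `` {x}"
  using assms by (auto simp: direct_sum_def elim: quotientE)

lemma class_in_direct_sum:
  "x \<in> dsum_terms A B \<Longrightarrow> dsum_rel A B `` {x} \<in> carrier (A \<boxplus> B)"
  by (auto simp: direct_sum_def intro: quotientI)

lemma class_eqI:
  assumes "heap A" "heap B" "(x, y) \<in> dsum_rel A B"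
  shows "dsum_rel A B `` {x} = dsum_rel A B `` {y}"
  by (rule equiv_class_eq[OF equiv_dsum_rel[OF assms(1,2)] assms(3)])

lemma hop_direct_sum_class:
  assumes "x \<in> dsum_terms A B" "y \<in> dsum_terms A B" "z \<in> dsum_terms A B"
  shows "hop (A \<boxplus> B) (dsum_rel A B `` {x}) (dsum_rel A B `` {y}) (dsum_rel A B `` {z})
    = dsum_rel A B `` {Op x y z}"
proof -
  have "(Op x y z, w) \<in> dsum_rel A B"
    if "(x, x') \<in> dsum_rel A B" "(y, y') \<in> dsum_rel A B" "(z, z') \<in> dsum_rel A B"
      "(Op x' y' z', w) \<in> dsum_rel A B" for x' y' z' w
    using that dsum_rel.cong dsum_rel.trans by metis
  then show ?thesis
    using assms by (force simp: direct_sum_def intro: dsum_rel.refl)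
qed

lemma direct_sum_abelian_heap:
  assumes "heap A" "heap B"
  shows "abelian_heap (A \<boxplus> B)"
proof -
  note eqs = dsum_rel.assoc[THEN class_eqI[OF assms]] dsum_rel.cancel_right[THEN class_eqI[OF assms]]
    dsum_rel.cancel_left[THEN class_eqI[OF assms]]
  note comm = dsum_rel.comm[THEN class_eqI[OF assms]]
  show ?thesis
    by unfold_locales
      (auto elim!: carrier_direct_sumE simp: hop_direct_sum_class dsum_terms.Op eqs
        intro: class_in_direct_sum[OF dsum_terms.Op] comm del: equalityI)
qed

lemma dsum_inl_hom:
  assumes "heap A" "heap B"
  shows "dsum_inl A B \<in> heap_hom A (A \<boxplus> B)"
  by (auto simp: heap_hom_def dsum_inl_def hop_direct_sum_class dsum_terms.Inl
      intro!: class_in_direct_sum class_eqI[OF assms] dsum_rel.Inl dsum_terms.Inl)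

lemma dsum_inr_hom:
  assumes "heap A" "heap B"
  shows "dsum_inr A B \<in> heap_hom B (A \<boxplus> B)"
  by (auto simp: heap_hom_def dsum_inr_def hop_direct_sum_class dsum_terms.Inr
      intro!: class_in_direct_sum class_eqI[OF assms] dsum_rel.Inr dsum_terms.Inr)

lemma direct_sum_generated:
  assumes "X \<in> carrier (A \<boxplus> B)"
    and "\<And>a. a \<in> carrier A \<Longrightarrow> P (dsum_inl A B a)"
    and "\<And>b. b \<in> carrier B \<Longrightarrow> P (dsum_inr A B b)"
    and "\<And>X Y Z. \<lbrakk>X \<in> carrier (A \<boxplus> B); Y \<in> carrier (A \<boxplus> B); Z \<in> carrier (A \<boxplus> B);
            P X; P Y; P Z\<rbrakk> \<Longrightarrow> P (hop (A \<boxplus> B) X Y Z)"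
  shows "P X"
proof -
  obtain x where x: "x \<in> dsum_terms A B" "X = dsum_rel A B `` {x}"
    using assms(1) by (rule carrier_direct_sumE)
  from x(1) have "P (dsum_rel A B `` {x})"
  proof induction
    case (Inl a)
    then show ?case using assms(2) by (simp add: dsum_inl_def)
  next
    case (Inr b)
    then show ?case using assms(3) by (simp add: dsum_inr_def)
  next
    case (Op x y z)
    then show ?case
      using assms(4)[OF class_in_direct_sum class_in_direct_sum class_in_direct_sum, of x y z]
      by (simp add: hop_direct_sum_class)
  qed
  with x(2) show ?thesis by simp
qed

primrec eval_hterm :: "('c, 'k) heap_scheme \<Rightarrow> ('x \<Rightarrow> 'c) \<Rightarrow> 'x hterm \<Rightarrow> 'c" where
  "eval_hterm C h (Gen x) = h x"
| "eval_hterm C h (Op x y z) =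
     hop C (eval_hterm C h x) (eval_hterm C h y) (eval_hterm C h z)"

theorem direct_sum_universal:
  fixes A :: "('a, 'm) heap_scheme" and B :: "('b, 'n) heap_scheme"
    and C :: "('c, 'k) heap_scheme"
  assumes "heap A" "heap B" "abelian_heap C"
    and f: "f \<in> heap_hom A C" and g: "g \<in> heap_hom B C"
  shows "\<exists>h \<in> heap_hom (A \<boxplus> B) C.
           (\<forall>a \<in> carrier A. h (dsum_inl A B a) = f a) \<and>
           (\<forall>b \<in> carrier B. h (dsum_inr A B b) = g b) \<and>
           (\<forall>h' \<in> heap_hom (A \<boxplus> B) C.
              (\<forall>a \<in> carrier A. h' (dsum_inl A B a) = f a) \<and>
              (\<forall>b \<in> carrier B. h' (dsum_inr A B b) = g b)
              \<longrightarrow> (\<forall>X \<in> carrier (A \<boxplus> B). h' X = h X))"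
proof -
  interpret C: abelian_heap C by fact
  define ev where "ev = eval_hterm C (case_sum f g)"
  define h where "h X = ev (SOME x. x \<in> X)" for X
  have ev_Op: "ev (Op x y z) = hop C (ev x) (ev y) (ev z)" for x y z
    by (simp add: ev_def)
  have ev_Gen: "ev (Gen (Inl a)) = f a" "ev (Gen (Inr b)) = g b" for a b
    by (simp_all add: ev_def)
  have ev_closed: "ev x \<in> carrier C" if "x \<in> dsum_terms A B" for x
    using that
    by induction (use f g in \<open>auto simp: ev_Op ev_Gen heap_hom_def intro: C.hop_closed\<close>)
  have ev_rel: "ev x = ev y" if "(x, y) \<in> dsum_rel A B" for x y
    using that
  proof induction
    case (comm x y z)
    then show ?case by (simp add: ev_Op ev_closed C.hop_comm[of "ev x"])
  qed (use f g in \<open>auto simp: ev_Op ev_Gen heap_hom_def ev_closed C.hop_assoc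
        C.hop_cancel_left C.hop_cancel_right\<close>)
  have h_class: "h (dsum_rel A B `` {x}) = ev x" if "x \<in> dsum_terms A B" for x
  proof -
    have "(x, SOME y. y \<in> dsum_rel A B `` {x}) \<in> dsum_rel A B"
      using someI[of "\<lambda>y. y \<in> dsum_rel A B `` {x}" x] dsum_rel.refl[OF that] by simp
    then show ?thesis using ev_rel by (simp add: h_def)
  qed
  have h_hom: "h \<in> heap_hom (A \<boxplus> B) C"
    by (auto simp: heap_hom_def hop_direct_sum_class h_class ev_closed ev_Op dsum_terms.Op
        elim!: carrier_direct_sumE)
  have h_inl: "h (dsum_inl A B a) = f a" if "a \<in> carrier A" for a
    using that by (simp add: dsum_inl_def h_class dsum_terms.Inl ev_Gen)
  have h_inr: "h (dsum_inr A B b) = g b" if "b \<in> carrier B" for b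
    using that by (simp add: dsum_inr_def h_class dsum_terms.Inr ev_Gen)
  have "h' X = h X"
    if h': "h' \<in> heap_hom (A \<boxplus> B) C"
      and "\<forall>a \<in> carrier A. h' (dsum_inl A B a) = f a"
      and "\<forall>b \<in> carrier B. h' (dsum_inr A B b) = g b"
      and X: "X \<in> carrier (A \<boxplus> B)" for h' X
    using X by (rule direct_sum_generated)
      (use that h_hom in \<open>simp_all add: heap_hom_def h_inl h_inr\<close>)
  then show ?thesis using h_hom h_inl h_inr by blast
qed

text \<open>The injections are one-to-one, so \<open>A\<close> and \<open>B\<close> may be identified with their images.\<close>

lemma dsum_inl_inj:
  assumes "abelian_heap A" "heap B"
  shows "inj_on (dsum_inl A B) (carrier A)"
proof (rule inj_onI)
  interpret A: abelian_heap A by fact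
  fix a a' assume a: "a \<in> carrier A" "a' \<in> carrier A" "dsum_inl A B a = dsum_inl A B a'"
  have "(\<lambda>x. x) \<in> heap_hom A A" "(\<lambda>_. a) \<in> heap_hom B A"
    using a by (auto simp: heap_hom_def A.hop_cancel_left)
  from direct_sum_universal[OF A.heap_axioms assms(2,1) this]
  show "a = a'" using a by metis
qed

lemma dsum_inr_inj:
  assumes "heap A" "abelian_heap B"
  shows "inj_on (dsum_inr A B) (carrier B)"
proof (rule inj_onI)
  interpret B: abelian_heap B by fact
  fix b b' assume b: "b \<in> carrier B" "b' \<in> carrier B" "dsum_inr A B b = dsum_inr A B b'"
  have "(\<lambda>x. x) \<in> heap_hom B B" "(\<lambda>_. b) \<in> heap_hom A B"
    using b by (auto simp: heap_hom_def B.hop_cancel_left)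
  from direct_sum_universal[OF assms(1) B.heap_axioms assms(2) this(2,1)]
  show "b = b'" using b by metis
qed


section \<open>Extending the multiplication of a truss to the direct sum with a singleton\<close>

definition bidistributive :: "('a, 'm) heap_scheme \<Rightarrow> ('a \<Rightarrow> 'a \<Rightarrow> 'a) \<Rightarrow> bool" where
  "bidistributive H m \<longleftrightarrow>
     (\<forall>s \<in> carrier H. \<forall>t \<in> carrier H. m s t \<in> carrier H) \<and>
     (\<forall>s \<in> carrier H. \<forall>t \<in> carrier H. \<forall>t' \<in> carrier H. \<forall>t'' \<in> carrier H.
        m s (hop H t t' t'') = hop H (m s t) (m s t') (m s t'') \<and>
        m (hop H t t' t'') s = hop H (m t s) (m t' s) (m t'' s))"

text \<open>
  The prescribed multiplication on \<open>T \<boxplus> I\<close>, where \<open>I\<close> has carrier \<open>{u}\<close> and \<open>u\<close> plays the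
  role of 1. Neither associativity nor an identity is required here.
\<close>

definition unital_ext_mult ::
    "('a, 'm) truss_scheme \<Rightarrow> ('b, 'n) truss_scheme \<Rightarrow> 'b \<Rightarrow>
     (('a + 'b) hterm set \<Rightarrow> ('a + 'b) hterm set \<Rightarrow> ('a + 'b) hterm set) \<Rightarrow> bool" where
  "unital_ext_mult T I u m \<longleftrightarrow>
     bidistributive (T \<boxplus> I) m \<and>
     (\<forall>t \<in> carrier T. m (dsum_inr T I u) (dsum_inl T I t) = dsum_inl T I t \<and>
                      m (dsum_inl T I t) (dsum_inr T I u) = dsum_inl T I t) \<and>
     (\<forall>t \<in> carrier T. \<forall>t' \<in> carrier T.
        m (dsum_inl T I t) (dsum_inl T I t') = dsum_inl T I (tmult T t t')) \<and>
     m (dsum_inr T I u) (dsum_inr T I u) = dsum_inr T I u"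

definition truss_on :: "('a, 'm) heap_scheme \<Rightarrow> ('a \<Rightarrow> 'a \<Rightarrow> 'a) \<Rightarrow> 'a truss" where
  "truss_on H m = \<lparr>carrier = carrier H, hop = hop H, tmult = m\<rparr>"

end

theory Submission
  imports Defs
begin

text \<open>
  A multiplication that distributes over the heap operation on both sides is a map of two
  arguments that is a heap homomorphism in each of them, and on \<open>T \<boxplus> I\<close> such a map is
  determined by its values on pairs of generators. This gives uniqueness, and the identity and
  associativity laws follow in the same way by checking them on generators, where they are
  immediate or reduce to associativity in \<open>T\<close>.

  Existence rests on \<open>direct_sum_bihom_left\<close>: maps \<open>A \<times> C \<rightarrow> E\<close> and \<open>B \<times> C \<rightarrow> E\<close> that are
  homomorphisms in each argument have a common extension to \<open>(A \<boxplus> B) \<times> C\<close>. The universal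
  property of the direct sum provides the extension for each fixed element of \<open>C\<close>; that
  it is a homomorphism in \<open>C\<close> as well holds because \<open>E\<close> is Abelian: by the medial law
  (\<open>hop_medial\<close>) the pointwise heap operation of three homomorphisms into \<open>E\<close> is again a
  homomorphism, so the two sides can be compared on generators. Two applications yield the
  multiplication: the first extends \<open>T \<times> T \<rightarrow> T \<boxplus> I\<close> in one argument, the other extends the
  result in the other argument. The pieces involving the generator 1 are projections, up to
  the inclusion of \<open>T\<close>.
\<close>

section \<open>The medial law in Abelian heaps\<close>

context heap
begin

text \<open>
  In a group, with \<open>[a, b, c] = a b\<^sup>-\<^sup>1 c\<close>, the next lemma is the rule for inverting a product.
  Commutativity is not needed.
\<close>

lemma hop_middle:
  assumes "a \<in> carrier H" "b \<in> carrier H" "c \<in> carrier H" "d \<in> carrier H" "e \<in> carrier H"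
  shows "hop H a (hop H b c d) e = hop H (hop H a d c) b e"
proof -
  let ?x = "hop H b c d"
  have x: "?x \<in> carrier H" using assms by (simp add: hop_closed)
  have a: "hop H (hop H a d c) b ?x = a"
  proof -
    have "hop H (hop H a d c) b ?x = hop H (hop H (hop H a d c) b b) c d"
      using assms by (simp add: hop_assoc hop_closed)
    also have "\<dots> = a"
      using assms by (simp add: hop_cancel_right hop_cancel_left hop_closed hop_assoc[of a d c c d])
    finally show ?thesis .
  qed
  \<comment> \<open>Insert \<open>e = [x, x, e]\<close> and shift the first \<open>x\<close> to the left, where it is absorbed.\<close>
  have "hop H (hop H a d c) b e = hop H (hop H a d c) b (hop H ?x ?x e)"
    using assms x by (simp add: hop_cancel_left)
  also have "\<dots> = hop H (hop H (hop H a d c) b ?x) ?x e"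
    using assms x by (simp add: hop_assoc hop_closed)
  finally show ?thesis by (simp add: a)
qed

end

context abelian_heap
begin

text \<open>
  Read additively, \<open>[[a, b, c], d, e]\<close> is \<open>a - b + c - d + e\<close>: the positive entries can be
  permuted among themselves, and so can the negative ones.
\<close>

lemma hop_swap_outer:
  assumes "a \<in> carrier H" "b \<in> carrier H" "c \<in> carrier H" "d \<in> carrier H" "e \<in> carrier H"
  shows "hop H (hop H a b c) d e = hop H (hop H a b e) d c"
  using assms by (simp add: hop_assoc hop_comm[of c d e])

lemma hop_swap_inner:
  assumes "a \<in> carrier H" "b \<in> carrier H" "c \<in> carrier H" "d \<in> carrier H" "e \<in> carrier H"
  shows "hop H (hop H a b c) d e = hop H (hop H a d c) b e"
proof -
  have "hop H (hop H a b c) d e = hop H (hop H a b e) d c"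
    using assms by (rule hop_swap_outer)
  also have "\<dots> = hop H c d (hop H a b e)"
    using assms by (simp add: hop_comm[of c] hop_closed)
  also have "\<dots> = hop H (hop H c d a) b e"
    using assms by (simp add: hop_assoc)
  also have "\<dots> = hop H (hop H a d c) b e"
    using assms by (simp add: hop_comm[of c])
  finally show ?thesis .
qed

lemma hop_swap_pairs:
  assumes "a \<in> carrier H" "b \<in> carrier H" "c \<in> carrier H" "d \<in> carrier H" "e \<in> carrier H"
  shows "hop H (hop H a b c) d e = hop H (hop H a d e) b c"
  using hop_swap_inner[OF assms] hop_swap_outer[of a d c b e] assms by simp

lemma hop_flatten:
  assumes "x \<in> carrier H" "a \<in> carrier H" "b \<in> carrier H" "c \<in> carrier H"
    and "a' \<in> carrier H" "b' \<in> carrier H" "c' \<in> carrier H"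
  shows "hop H x (hop H a b c) (hop H a' b' c')
    = hop H (hop H (hop H x a a') b' b) c c'"
proof -
  have "hop H x (hop H a b c) (hop H a' b' c') = hop H (hop H x c b) a (hop H a' b' c')"
    using assms by (simp add: hop_middle hop_closed)
  also have "\<dots> = hop H (hop H (hop H x c b) a a') b' c'"
    using assms by (simp add: hop_assoc hop_closed)
  also have "\<dots> = hop H (hop H (hop H x a a') c b) b' c'"
    using assms by (subst hop_swap_pairs) simp_all
  also have "\<dots> = hop H (hop H (hop H x a a') b' b) c c'"
    using assms by (intro hop_swap_inner) (simp_all add: hop_closed)
  finally show ?thesis .
qed

lemma hop_medial:
  assumes "a \<in> carrier H" "b \<in> carrier H" "c \<in> carrier H"
    and "a' \<in> carrier H" "b' \<in> carrier H" "c' \<in> carrier H"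
    and "a'' \<in> carrier H" "b'' \<in> carrier H" "c'' \<in> carrier H"
  shows "hop H (hop H a b c) (hop H a' b' c') (hop H a'' b'' c'')
    = hop H (hop H a a' a'') (hop H b b' b'') (hop H c c' c'')"
proof -
  have "hop H (hop H a b c) (hop H a' b' c') (hop H a'' b'' c'')
      = hop H (hop H (hop H (hop H a b c) a' a'') b'' b') c' c''"
    using assms by (intro hop_flatten) (simp_all add: hop_closed)
  also have "\<dots> = hop H (hop H (hop H (hop H a a' a'') b c) b'' b') c' c''"
    using assms by (subst hop_swap_pairs) simp_all
  also have "\<dots> = hop H (hop H (hop H (hop H a a' a'') b c) c' b') b'' c''"
    using assms by (intro hop_swap_inner) (simp_all add: hop_closed)
  also have "\<dots> = hop H (hop H a a' a'') (hop H b b' b'') (hop H c c' c'')"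
    using assms by (intro hop_flatten[symmetric]) (simp_all add: hop_closed)
  finally show ?thesis .
qed

end


section \<open>Maps that are heap homomorphisms in each argument\<close>

lemma heap_homI:
  assumes "\<And>a. a \<in> carrier A \<Longrightarrow> f a \<in> carrier B"
    and "\<And>a b c. \<lbrakk>a \<in> carrier A; b \<in> carrier A; c \<in> carrier A\<rbrakk>
      \<Longrightarrow> f (hop A a b c) = hop B (f a) (f b) (f c)"
  shows "f \<in> heap_hom A B"
  using assms by (simp add: heap_hom_def)

lemma heap_hom_closed: "\<lbrakk>f \<in> heap_hom A B; a \<in> carrier A\<rbrakk> \<Longrightarrow> f a \<in> carrier B"
  by (auto simp: heap_hom_def)

lemma heap_hom_hop:
  "\<lbrakk>f \<in> heap_hom A B; a \<in> carrier A; b \<in> carrier A; c \<in> carrier A\<rbrakk>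
    \<Longrightarrow> f (hop A a b c) = hop B (f a) (f b) (f c)"
  by (simp add: heap_hom_def)

lemma heap_hom_id: "(\<lambda>x. x) \<in> heap_hom A A"
  by (simp add: heap_hom_def)

text \<open>A constant map is a homomorphism because \<open>[b, b, b] = b\<close>.\<close>

lemma heap_hom_const:
  assumes "heap B" "b \<in> carrier B"
  shows "(\<lambda>_. b) \<in> heap_hom A B"
  using assms by (simp add: heap_hom_def heap.hop_cancel_left)

text \<open>
  The maps of two arguments that are heap homomorphisms in each argument separately. Nothing is
  required of their values outside the carriers.
\<close>

definition heap_bihom ::
    "('a, 'k) heap_scheme \<Rightarrow> ('b, 'm) heap_scheme \<Rightarrow> ('c, 'n) heap_scheme \<Rightarrow>
     ('a \<Rightarrow> 'b \<Rightarrow> 'c) set" where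
  "heap_bihom A B C = {p. (\<forall>a \<in> carrier A. p a \<in> heap_hom B C) \<and>
     (\<forall>b \<in> carrier B. (\<lambda>a. p a b) \<in> heap_hom A C)}"

lemma heap_bihomD1: "\<lbrakk>p \<in> heap_bihom A B C; a \<in> carrier A\<rbrakk> \<Longrightarrow> p a \<in> heap_hom B C"
  by (simp add: heap_bihom_def)

lemma heap_bihomD2: "\<lbrakk>p \<in> heap_bihom A B C; b \<in> carrier B\<rbrakk> \<Longrightarrow> (\<lambda>a. p a b) \<in> heap_hom A C"
  by (simp add: heap_bihom_def)

lemma heap_bihom_flip: "p \<in> heap_bihom A B C \<Longrightarrow> (\<lambda>b a. p a b) \<in> heap_bihom B A C"
  by (simp add: heap_bihom_def)

lemma bidistributive_iff_heap_bihom: "bidistributive H m \<longleftrightarrow> m \<in> heap_bihom H H H"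
  unfolding bidistributive_def heap_bihom_def heap_hom_def by auto

lemma direct_sum_hom_eqI:
  assumes f: "f \<in> heap_hom (A \<boxplus> B) C" and g: "g \<in> heap_hom (A \<boxplus> B) C"
    and "\<And>a. a \<in> carrier A \<Longrightarrow> f (dsum_inl A B a) = g (dsum_inl A B a)"
    and "\<And>b. b \<in> carrier B \<Longrightarrow> f (dsum_inr A B b) = g (dsum_inr A B b)"
    and "X \<in> carrier (A \<boxplus> B)"
  shows "f X = g X"
  using assms(5)
  by (rule direct_sum_generated)
    (simp_all add: assms(3,4) heap_hom_hop[OF f] heap_hom_hop[OF g])

text \<open>The universal property of the direct sum, with a parameter in \<open>C\<close>.\<close>

lemma direct_sum_bihom_left:
  fixes A :: "('a, 'k) heap_scheme" and B :: "('b, 'l) heap_scheme"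
    and C :: "('c, 'm) heap_scheme" and E :: "('d, 'n) heap_scheme"
  assumes "heap A" "heap B" "heap C" "abelian_heap E"
    and p: "p \<in> heap_bihom A C E" and q: "q \<in> heap_bihom B C E"
  obtains r where "r \<in> heap_bihom (A \<boxplus> B) C E"
    and "\<And>a c. \<lbrakk>a \<in> carrier A; c \<in> carrier C\<rbrakk> \<Longrightarrow> r (dsum_inl A B a) c = p a c"
    and "\<And>b c. \<lbrakk>b \<in> carrier B; c \<in> carrier C\<rbrakk> \<Longrightarrow> r (dsum_inr A B b) c = q b c"
proof -
  interpret C: heap C by fact
  interpret E: abelian_heap E by fact
  have "\<forall>c \<in> carrier C. \<exists>h \<in> heap_hom (A \<boxplus> B) E.
      (\<forall>a \<in> carrier A. h (dsum_inl A B a) = p a c) \<and>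
      (\<forall>b \<in> carrier B. h (dsum_inr A B b) = q b c)"
    using direct_sum_universal[OF assms(1,2,4) heap_bihomD2[OF p] heap_bihomD2[OF q]] by blast
  then obtain h where hom: "\<And>c. c \<in> carrier C \<Longrightarrow> h c \<in> heap_hom (A \<boxplus> B) E"
    and inl: "\<And>a c. \<lbrakk>a \<in> carrier A; c \<in> carrier C\<rbrakk> \<Longrightarrow> h c (dsum_inl A B a) = p a c"
    and inr: "\<And>b c. \<lbrakk>b \<in> carrier B; c \<in> carrier C\<rbrakk> \<Longrightarrow> h c (dsum_inr A B b) = q b c"
    by metis
  have "(\<lambda>c. h c X) \<in> heap_hom C E" if X: "X \<in> carrier (A \<boxplus> B)" for X
  proof (rule heap_homI)
    show "h c X \<in> carrier E" if "c \<in> carrier C" for c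
      using heap_hom_closed[OF hom[OF that] X] .
  next
    fix c c' c'' assume c: "c \<in> carrier C" "c' \<in> carrier C" "c'' \<in> carrier C"
    \<comment> \<open>Both sides of the homomorphism law are homomorphisms in \<open>X\<close>, so it suffices that they
      agree on generators.\<close>
    let ?k = "\<lambda>X. hop E (h c X) (h c' X) (h c'' X)"
    have "?k \<in> heap_hom (A \<boxplus> B) E"
    proof (rule heap_homI)
      show "?k X \<in> carrier E" if "X \<in> carrier (A \<boxplus> B)" for X
        using c that by (simp add: E.hop_closed heap_hom_closed[OF hom])
    next
      fix X Y Z assume "X \<in> carrier (A \<boxplus> B)" "Y \<in> carrier (A \<boxplus> B)" "Z \<in> carrier (A \<boxplus> B)"
      then show "?k (hop (A \<boxplus> B) X Y Z) = hop E (?k X) (?k Y) (?k Z)"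
        using c by (simp add: heap_hom_hop[OF hom] heap_hom_closed[OF hom]
            E.hop_medial[of "h c X" "h c Y" "h c Z"])
    qed
    from hom[OF C.hop_closed[OF c]] this _ _ X
    show "h (hop C c c' c'') X = ?k X"
      by (rule direct_sum_hom_eqI)
        (simp_all add: inl inr c C.hop_closed heap_hom_hop[OF heap_bihomD1[OF p]]
          heap_hom_hop[OF heap_bihomD1[OF q]])
  qed
  then have "(\<lambda>X c. h c X) \<in> heap_bihom (A \<boxplus> B) C E"
    by (simp add: heap_bihom_def hom)
  then show thesis using inl inr that by blast
qed

lemma direct_sum_bihom_eqI:
  assumes m: "m \<in> heap_bihom (A \<boxplus> B) (A \<boxplus> B) C" and m': "m' \<in> heap_bihom (A \<boxplus> B) (A \<boxplus> B) C"
    and "heap A" "heap B"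
    and ll: "\<And>a a'. \<lbrakk>a \<in> carrier A; a' \<in> carrier A\<rbrakk> \<Longrightarrow>
      m (dsum_inl A B a) (dsum_inl A B a') = m' (dsum_inl A B a) (dsum_inl A B a')"
    and lr: "\<And>a b. \<lbrakk>a \<in> carrier A; b \<in> carrier B\<rbrakk> \<Longrightarrow>
      m (dsum_inl A B a) (dsum_inr A B b) = m' (dsum_inl A B a) (dsum_inr A B b)"
    and rl: "\<And>b a. \<lbrakk>b \<in> carrier B; a \<in> carrier A\<rbrakk> \<Longrightarrow>
      m (dsum_inr A B b) (dsum_inl A B a) = m' (dsum_inr A B b) (dsum_inl A B a)"
    and rr: "\<And>b b'. \<lbrakk>b \<in> carrier B; b' \<in> carrier B\<rbrakk> \<Longrightarrow>
      m (dsum_inr A B b) (dsum_inr A B b') = m' (dsum_inr A B b) (dsum_inr A B b')"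
    and X: "X \<in> carrier (A \<boxplus> B)" and Y: "Y \<in> carrier (A \<boxplus> B)"
  shows "m X Y = m' X Y"
proof -
  note gens = heap_hom_closed[OF dsum_inl_hom[OF assms(3,4)]]
    heap_hom_closed[OF dsum_inr_hom[OF assms(3,4)]]
  have l: "m (dsum_inl A B a) Y = m' (dsum_inl A B a) Y" if "a \<in> carrier A" for a
    using heap_bihomD1[OF m gens(1)[OF that]] heap_bihomD1[OF m' gens(1)[OF that]]
      ll[OF that] lr[OF that] Y by (rule direct_sum_hom_eqI)
  have r: "m (dsum_inr A B b) Y = m' (dsum_inr A B b) Y" if "b \<in> carrier B" for b
    using heap_bihomD1[OF m gens(2)[OF that]] heap_bihomD1[OF m' gens(2)[OF that]]
      rl[OF that] rr[OF that] Y by (rule direct_sum_hom_eqI)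
  show ?thesis
    using heap_bihomD2[OF m Y] heap_bihomD2[OF m' Y] l r X
    by (rule direct_sum_hom_eqI)
qed


section \<open>Adjoining an identity to a truss\<close>

lemma unital_ext_mult_exists:
  fixes T :: "('a, 'm) truss_scheme" and I :: "('b, 'n) truss_scheme"
  assumes "truss T" "truss I" "carrier I = {u}"
  shows "\<exists>m. unital_ext_mult T I u m"
proof -
  interpret T: truss T by fact
  interpret I: truss I by fact
  let ?D = "T \<boxplus> I" and ?l = "dsum_inl T I" and ?r = "dsum_inr T I"
  interpret D: abelian_heap ?D by (rule direct_sum_abelian_heap) unfold_locales
  note inl = dsum_inl_hom[OF T.heap_axioms I.heap_axioms]
    and inr = dsum_inr_hom[OF T.heap_axioms I.heap_axioms]
  \<comment> \<open>Extend first in the right factor of the product; hence the exchanged arguments of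
    \<open>tmult\<close>.\<close>
  have TT: "(\<lambda>t' t. ?l (tmult T t t')) \<in> heap_bihom T T ?D"
    by (auto simp: heap_bihom_def T.tmult_closed T.tmult_hop_left T.tmult_hop_right
        heap_hom_closed[OF inl] heap_hom_hop[OF inl] intro!: heap_homI)
  have IT: "(\<lambda>_. ?l) \<in> heap_bihom I T ?D"
    by (auto simp: heap_bihom_def inl intro!: heap_hom_const D.heap_axioms heap_hom_closed[OF inl])
  obtain p where p: "p \<in> heap_bihom ?D T ?D"
    and p_inl: "\<And>t t'. \<lbrakk>t' \<in> carrier T; t \<in> carrier T\<rbrakk> \<Longrightarrow> p (?l t') t = ?l (tmult T t t')"
    and p_inr: "\<And>x t. \<lbrakk>x \<in> carrier I; t \<in> carrier T\<rbrakk> \<Longrightarrow> p (?r x) t = ?l t"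
    by (rule direct_sum_bihom_left[OF T.heap_axioms I.heap_axioms T.heap_axioms
        D.abelian_heap_axioms TT IT], rule that)
  \<comment> \<open>Now extend \<open>T \<times> (T \<boxplus> I) \<rightarrow> T \<boxplus> I\<close> in the left factor.\<close>
  have ID: "(\<lambda>_ Y. Y) \<in> heap_bihom I ?D ?D"
    by (auto simp: heap_bihom_def heap_hom_id intro: heap_hom_const D.heap_axioms)
  obtain m where m: "m \<in> heap_bihom ?D ?D ?D"
    and m_inl: "\<And>t Y. \<lbrakk>t \<in> carrier T; Y \<in> carrier ?D\<rbrakk> \<Longrightarrow> m (?l t) Y = p Y t"
    and m_inr: "\<And>x Y. \<lbrakk>x \<in> carrier I; Y \<in> carrier ?D\<rbrakk> \<Longrightarrow> m (?r x) Y = Y"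
    by (rule direct_sum_bihom_left[OF T.heap_axioms I.heap_axioms D.heap_axioms
        D.abelian_heap_axioms heap_bihom_flip[OF p] ID], rule that)
  have "unital_ext_mult T I u m"
    unfolding unital_ext_mult_def bidistributive_iff_heap_bihom
    using m by (simp add: assms(3) m_inl m_inr p_inl p_inr
        heap_hom_closed[OF inl] heap_hom_closed[OF inr])
  then show ?thesis by blast
qed

lemma unital_ext_mult_unique:
  fixes T :: "('a, 'm) truss_scheme" and I :: "('b, 'n) truss_scheme"
  assumes "heap T" "heap I" "carrier I = {u}"
    and "unital_ext_mult T I u m" "unital_ext_mult T I u m'"
    and "X \<in> carrier (T \<boxplus> I)" "Y \<in> carrier (T \<boxplus> I)"
  shows "m X Y = m' X Y"
proof -
  have "m \<in> heap_bihom (T \<boxplus> I) (T \<boxplus> I) (T \<boxplus> I)"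
    "m' \<in> heap_bihom (T \<boxplus> I) (T \<boxplus> I) (T \<boxplus> I)"
    using assms(4,5) by (simp_all add: unital_ext_mult_def bidistributive_iff_heap_bihom)
  from this assms(1,2) _ _ _ _ assms(6,7) show ?thesis
    by (rule direct_sum_bihom_eqI) (use assms(3-5) in \<open>simp_all add: unital_ext_mult_def\<close>)
qed

lemma unital_ext_mult_identity:
  fixes T :: "('a, 'm) truss_scheme" and I :: "('b, 'n) truss_scheme"
  assumes "heap T" "heap I" "carrier I = {u}"
    and m: "unital_ext_mult T I u m" and X: "X \<in> carrier (T \<boxplus> I)"
  shows "m (dsum_inr T I u) X = X" "m X (dsum_inr T I u) = X"
proof -
  have u: "dsum_inr T I u \<in> carrier (T \<boxplus> I)"
    using heap_hom_closed[OF dsum_inr_hom[OF assms(1,2)]] assms(3) by simp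
  have b: "m \<in> heap_bihom (T \<boxplus> I) (T \<boxplus> I) (T \<boxplus> I)"
    using m by (simp add: unital_ext_mult_def bidistributive_iff_heap_bihom)
  show "m (dsum_inr T I u) X = X"
    by (rule direct_sum_hom_eqI[OF heap_bihomD1[OF b u] heap_hom_id _ _ X])
      (use m assms(3) in \<open>simp_all add: unital_ext_mult_def\<close>)
  show "m X (dsum_inr T I u) = X"
    by (rule direct_sum_hom_eqI[OF heap_bihomD2[OF b u] heap_hom_id _ _ X])
      (use m assms(3) in \<open>simp_all add: unital_ext_mult_def\<close>)
qed

text \<open>
  On generators either one factor is the identity or associativity is that of \<open>T\<close>.
\<close>

lemma unital_ext_mult_assoc:
  fixes T :: "('a, 'm) truss_scheme" and I :: "('b, 'n) truss_scheme"
  assumes "truss T" "heap I" and I: "carrier I = {u}"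
    and m: "unital_ext_mult T I u m"
    and X: "X \<in> carrier (T \<boxplus> I)" and Y: "Y \<in> carrier (T \<boxplus> I)" and Z: "Z \<in> carrier (T \<boxplus> I)"
  shows "m (m X Y) Z = m X (m Y Z)"
proof -
  interpret T: truss T by fact
  let ?D = "T \<boxplus> I" and ?l = "dsum_inl T I" and ?r = "dsum_inr T I"
  note l_closed = heap_hom_closed[OF dsum_inl_hom[OF T.heap_axioms assms(2)]]
  note one = unital_ext_mult_identity[OF T.heap_axioms assms(2) I m]
  have b: "m \<in> heap_bihom ?D ?D ?D"
    using m by (simp add: unital_ext_mult_def bidistributive_iff_heap_bihom)
  have ll: "m (?l s) (?l t) = ?l (tmult T s t)" if "s \<in> carrier T" "t \<in> carrier T" for s t
    using m that by (simp add: unital_ext_mult_def)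
  have closed: "m V W \<in> carrier ?D" if "V \<in> carrier ?D" "W \<in> carrier ?D" for V W
    using heap_hom_closed[OF heap_bihomD1[OF b]] that .
  note hop_r = heap_hom_hop[OF heap_bihomD1[OF b]]
    and hop_l = heap_hom_hop[OF heap_bihomD2[OF b]]
  \<comment> \<open>Replace the arguments by arbitrary elements one at a time, starting from the right.\<close>
  have 1: "m (m (?l r) (?l s)) Z = m (?l r) (m (?l s) Z)"
    if "r \<in> carrier T" "s \<in> carrier T" for r s
    using Z that
    by (induction Z rule: direct_sum_generated[consumes 1])
      (simp_all add: I ll T.tmult_closed T.tmult_assoc one l_closed closed hop_r)
  have 2: "m (m (?l r) Y) Z = m (?l r) (m Y Z)" if "r \<in> carrier T" for r
    using Y that
    by (induction Y rule: direct_sum_generated[consumes 1])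
      (simp_all add: I 1 one Z l_closed closed hop_r hop_l)
  show ?thesis
    using X
    by (induction X rule: direct_sum_generated[consumes 1])
      (simp_all add: I 2 one Y Z l_closed closed hop_l)
qed

theorem proposition3p12:
  fixes T :: "('a, 'm) truss_scheme" and I :: "('b, 'n) truss_scheme" and u :: 'b
  assumes "truss T" and "truss I" and "carrier I = {u}"
  shows "(\<exists>m. unital_ext_mult T I u m) \<and>
         (\<forall>m m'. unital_ext_mult T I u m \<and> unital_ext_mult T I u m' \<longrightarrow>
            (\<forall>x \<in> carrier (T \<boxplus> I). \<forall>y \<in> carrier (T \<boxplus> I). m x y = m' x y)) \<and>
         (\<forall>m. unital_ext_mult T I u m \<longrightarrow>
            unital_truss (truss_on (T \<boxplus> I) m) \<and>
            is_identity (truss_on (T \<boxplus> I) m) (dsum_inr T I u))"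
proof (intro conjI allI impI)
  interpret T: truss T by fact
  interpret I: truss I by fact
  interpret D: abelian_heap "T \<boxplus> I" by (rule direct_sum_abelian_heap) unfold_locales
  note TI = T.heap_axioms I.heap_axioms
  show "\<exists>m. unital_ext_mult T I u m"
    using assms by (rule unital_ext_mult_exists)
  show "\<forall>x \<in> carrier (T \<boxplus> I). \<forall>y \<in> carrier (T \<boxplus> I). m x y = m' x y"
    if "unital_ext_mult T I u m \<and> unital_ext_mult T I u m'" for m m'
    using unital_ext_mult_unique[OF TI assms(3)] that by blast
  fix m assume m: "unital_ext_mult T I u m"
  have u: "dsum_inr T I u \<in> carrier (T \<boxplus> I)"
    using heap_hom_closed[OF dsum_inr_hom[OF TI]] assms(3) by simp
  show id: "is_identity (truss_on (T \<boxplus> I) m) (dsum_inr T I u)"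
    using u unital_ext_mult_identity[OF TI assms(3) m] by (simp add: is_identity_def truss_on_def)
  have "bidistributive (T \<boxplus> I) m"
    using m by (simp add: unital_ext_mult_def)
  then have "truss (truss_on (T \<boxplus> I) m)"
    using unital_ext_mult_assoc[OF assms(1) TI(2) assms(3) m]
    by unfold_locales
      (auto simp: truss_on_def bidistributive_def D.hop_closed D.hop_assoc D.hop_cancel_left
        D.hop_cancel_right intro: D.hop_comm del: equalityI)
  then show "unital_truss (truss_on (T \<boxplus> I) m)"
    using id by (auto simp: unital_truss_def unital_truss_axioms_def)
qed

end
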